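(* Let $G$ be a finite abstract simplicial complex and let $h: G\to\{-1,1\}$ be any function. Then the matrix $g=SL^{++}S$ is the inverse of the matrix $L=L^{--}$.
   Context: A finite abstract simplicial complex $G$ is a finite set of finite non-empty sets closed under the operation of taking non-empty subsets. For $x\in G$ let $W^+(x)=\{y\in G: x\subset y\}$ and $W^-(x)=\{y\in G: y\subset x\}$ (both include $x$). Let $|x|$ be the cardinality of $x$, $\dim(x)=|x|-1$ and $\omega(x)=(-1)^{\dim(x)}$. For a function $h$ on $G$ and $A\subset G$ put $E[A]=\sum_{x\in A}h(x)$ (with $E[\emptyset]=0$). The matrices, indexed by $G\times G$, are $L^{--}(x,y)=E[W^-(x)\cap W^-(y)]$, $L^{++}(x,y)=E[W^+(x)\cap W^+(y)]$, and $S(x,y)=\omega(x)$ if $x=y$ and $0$ otherwise. Set $L=L^{--}$ and $g=SL^{++}S$. *)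

theory Defs
  imports "Jordan_Normal_Form.Matrix"
begin

definition simplicial_complex :: "'a set set \<Rightarrow> bool" where
  "simplicial_complex G \<longleftrightarrow>
     finite G \<and> (\<forall>x\<in>G. finite x \<and> x \<noteq> {}) \<and>
     (\<forall>x\<in>G. \<forall>y. y \<subseteq> x \<and> y \<noteq> {} \<longrightarrow> y \<in> G)"

definition W_plus :: "'a set set \<Rightarrow> 'a set \<Rightarrow> 'a set set" where
  "W_plus G x = {y \<in> G. x \<subseteq> y}"

definition W_minus :: "'a set set \<Rightarrow> 'a set \<Rightarrow> 'a set set" where
  "W_minus G x = {y \<in> G. y \<subseteq> x}"

(* Simplices are nonempty, so the subtraction on nat does not truncate. *)
definition simplex_dim :: "'a set \<Rightarrow> nat" where
  "simplex_dim x = card x - 1"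

definition omega :: "'a set \<Rightarrow> int" where
  "omega x = (-1) ^ simplex_dim x"

definition energy :: "('a set \<Rightarrow> int) \<Rightarrow> 'a set set \<Rightarrow> int" where
  "energy h A = (\<Sum>x\<in>A. h x)"

(* A matrix indexed by G x G is represented as a library matrix by means of
   an enumeration xs of G (a distinct list with set xs = G):
   row i and column j belong to the simplices xs ! i and xs ! j. *)
definition indexed_mat :: "'i list \<Rightarrow> ('i \<Rightarrow> 'i \<Rightarrow> int) \<Rightarrow> int mat" where
  "indexed_mat xs f = mat (length xs) (length xs) (\<lambda>(i, j). f (xs ! i) (xs ! j))"

definition L_minus_minus :: "('a set \<Rightarrow> int) \<Rightarrow> 'a set list \<Rightarrow> int mat" where
  "L_minus_minus h xs =
     indexed_mat xs (\<lambda>x y. energy h (W_minus (set xs) x \<inter> W_minus (set xs) y))"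

definition L_plus_plus :: "('a set \<Rightarrow> int) \<Rightarrow> 'a set list \<Rightarrow> int mat" where
  "L_plus_plus h xs =
     indexed_mat xs (\<lambda>x y. energy h (W_plus (set xs) x \<inter> W_plus (set xs) y))"

definition S_mat :: "'a set list \<Rightarrow> int mat" where
  "S_mat xs = indexed_mat xs (\<lambda>x y. if x = y then omega x else 0)"

definition g_mat :: "('a set \<Rightarrow> int) \<Rightarrow> 'a set list \<Rightarrow> int mat" where
  "g_mat h xs = S_mat xs * L_plus_plus h xs * S_mat xs"

end

theory Submission
  imports Defs
begin

text \<open>
  Let \<open>Z(x, y) = 1\<close> if \<open>y \<subseteq> x\<close> and \<open>0\<close> otherwise (the zeta matrix of the face poset), and let \<open>D\<close> be
  the diagonal matrix of \<open>h\<close>. Summing over the simplex at which the energy is collected gives the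
  factorisations \<open>L\<^sup>-\<^sup>- = Z D Z\<^sup>T\<close> and \<open>L\<^sup>+\<^sup>+ = Z\<^sup>T D Z\<close>
  (\<open>L_minus_minus_factorization\<close>, \<open>L_plus_plus_factorization\<close>).

  For a simplicial complex the Moebius function of the face poset is \<open>\<omega>(x) \<omega>(y)\<close>, because every
  interval \<open>[y, x]\<close> of nonempty faces is a Boolean lattice, in which the signs cancel unless
  \<open>x = y\<close>. In matrix form the inverse of \<open>Z\<close> is \<open>B = S Z S\<close> (\<open>zeta_mat_Moebius_inversion\<close>).

  Diagonal matrices commute and \<open>S\<^sup>2 = 1\<close>, so
  \<open>g = S Z\<^sup>T D Z S = (S Z\<^sup>T S) D (S Z S) = B\<^sup>T D B\<close>. As \<open>h\<close> has values \<open>\<plusminus>1\<close>, also \<open>D\<^sup>2 = 1\<close>, and the product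
  \<open>(Z D Z\<^sup>T) (B\<^sup>T D B)\<close> collapses from the middle outwards; so does the product in the other order
  (\<open>congruence_inverse\<close>).
\<close>

section \<open>Matrices indexed by a finite set\<close>

lemma indexed_mat_carrier [simp]:
  "indexed_mat xs f \<in> carrier_mat (length xs) (length xs)"
  by (simp add: indexed_mat_def)

lemma indexed_mat_dim [simp]:
  "dim_row (indexed_mat xs f) = length xs" "dim_col (indexed_mat xs f) = length xs"
  by (simp_all add: indexed_mat_def)

lemma indexed_mat_cong:
  assumes "\<And>x y. x \<in> set xs \<Longrightarrow> y \<in> set xs \<Longrightarrow> f x y = f' x y"
  shows "indexed_mat xs f = indexed_mat xs f'"
  using assms by (auto simp: indexed_mat_def)

lemma indexed_mat_transpose:
  "transpose_mat (indexed_mat xs f) = indexed_mat xs (\<lambda>x y. f y x)"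
  by (auto simp: indexed_mat_def)

lemma indexed_mat_one:
  assumes "distinct xs"
  shows "indexed_mat xs (\<lambda>x y. if x = y then 1 else 0) = 1\<^sub>m (length xs)"
  using assms by (auto simp: indexed_mat_def nth_eq_iff_index_eq)

lemma indexed_mat_mult:
  assumes "distinct xs"
  shows "indexed_mat xs f * indexed_mat xs f' = indexed_mat xs (\<lambda>x y. \<Sum>z\<in>set xs. f x z * f' z y)"
proof -
  have "(\<Sum>k = 0..<length xs. f x (xs ! k) * f' (xs ! k) y) = (\<Sum>z\<in>set xs. f x z * f' z y)" for x y
    using sum.reindex_bij_betw[OF bij_betw_nth[OF assms refl refl], of "\<lambda>z. f x z * f' z y"]
    by (simp add: lessThan_atLeast0)
  then show ?thesis
    by (auto simp: indexed_mat_def scalar_prod_def)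
qed

definition diagonal_mat_of :: "'i list \<Rightarrow> ('i \<Rightarrow> int) \<Rightarrow> int mat" where
  "diagonal_mat_of xs d = indexed_mat xs (\<lambda>x y. if x = y then d x else 0)"

lemma diagonal_mat_of_carrier [simp]:
  "diagonal_mat_of xs d \<in> carrier_mat (length xs) (length xs)"
  by (simp add: diagonal_mat_of_def)

lemma diagonal_mat_of_transpose:
  "transpose_mat (diagonal_mat_of xs d) = diagonal_mat_of xs d"
  unfolding diagonal_mat_of_def indexed_mat_transpose by (rule indexed_mat_cong) auto

lemma diagonal_mat_of_mult_left:
  assumes "distinct xs"
  shows "diagonal_mat_of xs d * indexed_mat xs f = indexed_mat xs (\<lambda>x y. d x * f x y)"
  unfolding diagonal_mat_of_def indexed_mat_mult[OF assms]
  by (rule indexed_mat_cong) (simp add: if_distrib[of "\<lambda>t. t * _"] cong: if_cong)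

lemma diagonal_mat_of_mult_right:
  assumes "distinct xs"
  shows "indexed_mat xs f * diagonal_mat_of xs d = indexed_mat xs (\<lambda>x y. f x y * d y)"
  unfolding diagonal_mat_of_def indexed_mat_mult[OF assms]
  by (rule indexed_mat_cong) (simp add: if_distrib[of "\<lambda>t. _ * t"] cong: if_cong)

lemma diagonal_mat_of_commute:
  assumes "distinct xs"
  shows "diagonal_mat_of xs d * diagonal_mat_of xs e = diagonal_mat_of xs e * diagonal_mat_of xs d"
proof -
  have "diagonal_mat_of xs d * diagonal_mat_of xs e
      = indexed_mat xs (\<lambda>x y. d x * (if x = y then e x else 0))"
    using diagonal_mat_of_mult_left[OF assms] by (simp add: diagonal_mat_of_def)
  also have "\<dots> = indexed_mat xs (\<lambda>x y. (if x = y then e x else 0) * d y)"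
    by (rule indexed_mat_cong) simp
  also have "\<dots> = diagonal_mat_of xs e * diagonal_mat_of xs d"
    using diagonal_mat_of_mult_right[OF assms] by (simp add: diagonal_mat_of_def)
  finally show ?thesis .
qed

lemma diagonal_mat_of_involution:
  assumes "distinct xs" and "\<And>x. x \<in> set xs \<Longrightarrow> d x * d x = 1"
  shows "diagonal_mat_of xs d * diagonal_mat_of xs d = 1\<^sub>m (length xs)"
proof -
  have "diagonal_mat_of xs d * diagonal_mat_of xs d
      = indexed_mat xs (\<lambda>x y. d x * (if x = y then d x else 0))"
    using diagonal_mat_of_mult_left[OF assms(1)] by (simp add: diagonal_mat_of_def)
  also have "\<dots> = indexed_mat xs (\<lambda>x y. if x = y then 1 else 0)"
    by (rule indexed_mat_cong) (simp add: assms(2))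
  finally show ?thesis
    by (simp add: indexed_mat_one[OF assms(1)])
qed

section \<open>The zeta matrix of the face poset\<close>

definition zeta_mat :: "'a set list \<Rightarrow> int mat" where
  "zeta_mat xs = indexed_mat xs (\<lambda>x y. if y \<subseteq> x then 1 else 0)"

lemma zeta_mat_carrier [simp]: "zeta_mat xs \<in> carrier_mat (length xs) (length xs)"
  by (simp add: zeta_mat_def)

lemma L_minus_minus_factorization:
  assumes "distinct xs"
  shows "L_minus_minus h xs = zeta_mat xs * diagonal_mat_of xs h * transpose_mat (zeta_mat xs)"
proof -
  have "energy h (W_minus (set xs) x \<inter> W_minus (set xs) y)
      = (\<Sum>z\<in>set xs. (if z \<subseteq> x then 1 else 0) * h z * (if z \<subseteq> y then 1 else 0))" for x y
    unfolding energy_def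
    by (rule sum.mono_neutral_cong_left) (auto simp: W_minus_def)
  then show ?thesis
    unfolding L_minus_minus_def zeta_mat_def indexed_mat_transpose
      diagonal_mat_of_mult_right[OF assms] indexed_mat_mult[OF assms]
    by simp
qed

lemma L_plus_plus_factorization:
  assumes "distinct xs"
  shows "L_plus_plus h xs = transpose_mat (zeta_mat xs) * diagonal_mat_of xs h * zeta_mat xs"
proof -
  have "energy h (W_plus (set xs) x \<inter> W_plus (set xs) y)
      = (\<Sum>z\<in>set xs. (if x \<subseteq> z then 1 else 0) * h z * (if y \<subseteq> z then 1 else 0))" for x y
    unfolding energy_def
    by (rule sum.mono_neutral_cong_left) (auto simp: W_plus_def)
  then show ?thesis
    unfolding L_plus_plus_def zeta_mat_def indexed_mat_transpose
      diagonal_mat_of_mult_right[OF assms] indexed_mat_mult[OF assms]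
    by simp
qed

lemma omega_square: "omega x * omega x = 1"
  by (simp add: omega_def flip: power_mult_distrib)

lemma omega_nonempty:
  assumes "finite x" "x \<noteq> {}"
  shows "omega x = - ((-1) ^ card x)"
proof -
  have "card x = Suc (simplex_dim x)"
    using assms by (simp add: simplex_dim_def card_gt_0_iff)
  then show ?thesis
    by (simp add: omega_def)
qed

text \<open>
  The faces between \<open>y\<close> and \<open>x\<close> are exactly the sets between them: such a set is a nonempty subset of
  \<open>x\<close>, hence a simplex. They therefore form a Boolean lattice, and if \<open>y \<noteq> x\<close> it has as many
  members of even as of odd cardinality.
\<close>
lemma sum_omega_interval:
  assumes "simplicial_complex G" "x \<in> G" "y \<in> G"
  shows "(\<Sum>z | z \<in> G \<and> y \<subseteq> z \<and> z \<subseteq> x. omega z) = (if x = y then omega x else 0)"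
proof -
  have x: "finite x" and y: "y \<noteq> {}"
    using assms unfolding simplicial_complex_def by blast+
  have "z \<in> G" if "z \<subseteq> x" "y \<subseteq> z" for z
    using assms(1,2) that y unfolding simplicial_complex_def by (metis subset_empty)
  then have faces: "{z \<in> G. y \<subseteq> z \<and> z \<subseteq> x} = {z. z \<subseteq> x \<and> y \<subseteq> z}"
    by blast
  consider "x = y" | "y \<subset> x" | "\<not> y \<subseteq> x"
    by blast
  then show ?thesis
  proof cases
    case 1
    then have singleton: "{z. z \<subseteq> x \<and> y \<subseteq> z} = {x}"
      by blast
    show ?thesis
      unfolding faces singleton using 1 by simp
  next
    case 2
    have "(\<Sum>z | z \<subseteq> x \<and> y \<subseteq> z. omega z) = (\<Sum>z | z \<subseteq> x \<and> y \<subseteq> z. - ((-1) ^ card z))"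
      using x y by (intro sum.cong refl omega_nonempty) (auto dest: finite_subset)
    also have "\<dots> = - (\<Sum>z | z \<subseteq> x \<and> y \<subseteq> z. (-1) ^ card z)"
      by (rule sum_negf)
    also have "(\<Sum>z | z \<subseteq> x \<and> y \<subseteq> z. (-1) ^ card z) = (0::int)"
      using x card_subsupersets_even_odd[OF x 2]
      by (intro sum_alternating_cancels) simp_all
    finally show ?thesis
      using 2 unfolding faces by auto
  next
    case 3
    then have empty: "{z. z \<subseteq> x \<and> y \<subseteq> z} = {}" and "x \<noteq> y"
      by blast+
    then show ?thesis
      unfolding faces empty by simp
  qed
qed

lemma S_mat_eq_diagonal: "S_mat xs = diagonal_mat_of xs omega"
  by (simp add: S_mat_def diagonal_mat_of_def)

lemma zeta_mat_Moebius_inversion: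
  assumes "simplicial_complex (set xs)" "distinct xs"
  shows "zeta_mat xs * (S_mat xs * zeta_mat xs * S_mat xs) = 1\<^sub>m (length xs)"
proof -
  have "(\<Sum>z\<in>set xs. (if z \<subseteq> x then 1 else 0) * (omega z * (if y \<subseteq> z then 1 else 0) * omega y))
      = (if x = y then 1 else 0)" if "x \<in> set xs" "y \<in> set xs" for x y
  proof -
    have "(\<Sum>z\<in>set xs. (if z \<subseteq> x then 1 else 0) * (omega z * (if y \<subseteq> z then 1 else 0) * omega y))
        = (\<Sum>z | z \<in> set xs \<and> y \<subseteq> z \<and> z \<subseteq> x. omega z * omega y)"
      by (rule sum.mono_neutral_cong_right) auto
    also have "\<dots> = (if x = y then omega x else 0) * omega y"
      by (simp add: sum_omega_interval[OF assms(1) that] flip: sum_distrib_right)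
    finally show ?thesis
      by (simp add: omega_square)
  qed
  then show ?thesis
    unfolding S_mat_eq_diagonal zeta_mat_def diagonal_mat_of_mult_left[OF assms(2)]
      diagonal_mat_of_mult_right[OF assms(2)] indexed_mat_mult[OF assms(2)]
      indexed_mat_one[OF assms(2), symmetric]
    by (intro indexed_mat_cong)
qed

section \<open>Inverting a congruence\<close>

text \<open>
  A one-sided inverse of the form \<open>S Z S\<close> is automatically two-sided: conjugating
  \<open>Z S Z S = 1\<close> by \<open>S\<close> gives \<open>S Z S Z = 1\<close>.
\<close>
lemma conjugate_inverse_commute:
  fixes Z S :: "'a::semiring_1 mat"
  assumes [simp]: "Z \<in> carrier_mat n n" "S \<in> carrier_mat n n"
    and SS: "S * S = 1\<^sub>m n" and inv: "Z * (S * Z * S) = 1\<^sub>m n"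
  shows "S * Z * S * Z = 1\<^sub>m n"
proof -
  note assoc = assoc_mult_mat[of _ n n _ n _ n] and closed = mult_carrier_mat[of _ n n _ n]
    and one = right_mult_one_mat[of _ n n]
  have "S * Z * S * Z = S * Z * S * Z * (S * S)"
    by (simp add: SS closed one)
  also have "\<dots> = S * (Z * (S * Z * S)) * S"
    by (simp add: assoc closed)
  finally show ?thesis
    by (simp add: inv SS one)
qed

text \<open>
  Transposing \<open>A B = 1 = B A\<close> shows that \<open>A\<^sup>T\<close> and \<open>B\<^sup>T\<close> are also inverse to each other. In each of the
  two products an adjacent pair of inverses meets in the middle; once it is gone, the two copies of
  \<open>D\<close> meet and cancel, and then the outer pair does.
\<close>
lemma congruence_inverse:
  fixes A B D :: "'a::comm_semiring_1 mat"
  assumes [simp]: "A \<in> carrier_mat n n" "B \<in> carrier_mat n n" "D \<in> carrier_mat n n"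
    and AB: "A * B = 1\<^sub>m n" and BA: "B * A = 1\<^sub>m n" and DD: "D * D = 1\<^sub>m n"
  shows "(A * D * transpose_mat A) * (transpose_mat B * D * B) = 1\<^sub>m n"
    and "(transpose_mat B * D * B) * (A * D * transpose_mat A) = 1\<^sub>m n"
proof -
  note assoc = assoc_mult_mat[of _ n n _ n _ n] and closed = mult_carrier_mat[of _ n n _ n]
    and one = right_mult_one_mat[of _ n n]
  have AB': "transpose_mat A * transpose_mat B = 1\<^sub>m n"
    using transpose_mult[of B n n A n] by (simp add: BA)
  have BA': "transpose_mat B * transpose_mat A = 1\<^sub>m n"
    using transpose_mult[of A n n B n] by (simp add: AB)
  have "(A * D * transpose_mat A) * (transpose_mat B * D * B)
      = A * (D * (transpose_mat A * transpose_mat B) * D) * B"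
    by (simp add: assoc closed)
  then show "(A * D * transpose_mat A) * (transpose_mat B * D * B) = 1\<^sub>m n"
    by (simp add: AB' DD AB one)
  have "(transpose_mat B * D * B) * (A * D * transpose_mat A)
      = transpose_mat B * (D * (B * A) * D) * transpose_mat A"
    by (simp add: assoc closed)
  then show "(transpose_mat B * D * B) * (A * D * transpose_mat A) = 1\<^sub>m n"
    by (simp add: BA DD BA' one)
qed

theorem theorem2:
  fixes G :: "'a set set" and h :: "'a set \<Rightarrow> int" and xs :: "'a set list"
  assumes "simplicial_complex G"
    and "\<forall>x\<in>G. h x \<in> {-1, 1}"
    and "distinct xs" and "set xs = G"
  shows "inverts_mat (L_minus_minus h xs) (g_mat h xs)
       \<and> inverts_mat (g_mat h xs) (L_minus_minus h xs)"
proof -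
  let ?n = "length xs" and ?Z = "zeta_mat xs" and ?S = "S_mat xs" and ?D = "diagonal_mat_of xs h"
  let ?B = "?S * ?Z * ?S"
  note assoc = assoc_mult_mat[of _ ?n ?n _ ?n _ ?n] and closed = mult_carrier_mat[of _ ?n ?n _ ?n]
    and one = right_mult_one_mat[of _ ?n ?n]
  have [simp]: "?S \<in> carrier_mat ?n ?n"
    by (simp add: S_mat_eq_diagonal)
  have SS: "?S * ?S = 1\<^sub>m ?n"
    by (simp add: S_mat_eq_diagonal diagonal_mat_of_involution assms(3) omega_square)
  have DD: "?D * ?D = 1\<^sub>m ?n"
    using assms by (intro diagonal_mat_of_involution) auto
  have ZB: "?Z * ?B = 1\<^sub>m ?n"
    using assms by (intro zeta_mat_Moebius_inversion) auto
  have BZ: "?B * ?Z = 1\<^sub>m ?n"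
    by (rule conjugate_inverse_commute[OF _ _ SS ZB]) simp_all
  \<comment> \<open>Replacing \<open>D\<close> by \<open>S D S\<close> supplies the inner factors \<open>S\<close> that turn \<open>S Z\<^sup>T D Z S\<close> into \<open>B\<^sup>T D B\<close>.\<close>
  have SDS: "?S * ?D * ?S = ?D"
  proof -
    have "?S * ?D * ?S = ?D * ?S * ?S"
      using diagonal_mat_of_commute[OF assms(3), of omega h] by (simp add: S_mat_eq_diagonal)
    also have "\<dots> = ?D * (?S * ?S)"
      by (simp add: assoc closed)
    finally show ?thesis
      by (simp add: SS one)
  qed
  have BT: "transpose_mat ?B = ?S * transpose_mat ?Z * ?S"
    by (simp add: transpose_mult[of _ ?n ?n _ ?n] S_mat_eq_diagonal diagonal_mat_of_transpose assoc closed)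
  have "g_mat h xs = ?S * transpose_mat ?Z * ?D * (?Z * ?S)"
    by (simp add: g_mat_def L_plus_plus_factorization[OF assms(3)] assoc closed)
  also have "\<dots> = ?S * transpose_mat ?Z * (?S * ?D * ?S) * (?Z * ?S)"
    by (simp only: SDS)
  also have "\<dots> = transpose_mat ?B * ?D * ?B"
    unfolding BT by (simp add: assoc closed)
  finally have g: "g_mat h xs = transpose_mat ?B * ?D * ?B" .
  have "?B \<in> carrier_mat ?n ?n"
    by (simp add: closed)
  note congruence = congruence_inverse[OF zeta_mat_carrier this diagonal_mat_of_carrier ZB BZ DD]
  have "dim_row (L_minus_minus h xs) = ?n" "dim_row (g_mat h xs) = ?n"
    by (simp_all add: L_minus_minus_def g_mat_def S_mat_def)
  then show ?thesis
    using congruence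
    unfolding inverts_mat_def L_minus_minus_factorization[OF assms(3)] g by simp
qed

end
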